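(* Let $I\subseteq\mathbb{R}$ be a nonempty open interval, $d\ge2$, let $(f,g),(h,k)\in\mathscr{C}_1(I)$ be Chebyshev systems, let $T$ be a (nonempty) compact and connected topological space and let $m:I^d\times T\to I$ be a continuous family of $d$-variable means. Define $$U_m:=\{(u,v)\mid \exists\,\pmb{x}\in I^d:\ u,v\in[\underline{m}(\pmb{x}),\overline{m}(\pmb{x})]\}=\bigcup_{\pmb{x}\in I^d}[\underline{m}(\pmb{x}),\overline{m}(\pmb{x})]^2 .$$ The following three assertions are equivalent: (i) for all Borel probability measures $\mu$ on $T$, $$M_{f,g,m;\mu}(\pmb{x})\le M_{h,k,m;\mu}(\pmb{x})\qquad(\pmb{x}\in I^d);$$ (ii) there exists a null sequence $(\gamma_j)$ of positive numbers in $[0,1]$ such that, for all $t_0,t\in T$ and for all $j\in\mathbb{N}$, $$M_{f,g,m;(1-\gamma_j)\delta_{t_0}+\gamma_j\delta_t}(\pmb{x})\le M_{h,k,m;(1-\gamma_j)\delta_{t_0}+\gamma_j\delta_t}(\pmb{x})\qquad(\pmb{x}\in I^d);$$ (iii) for all $(u,v)\in U_m$, $$\frac{\mathscr{D}_{f,g}(u,v)}{\partial_1\mathscr{D}_{f,g}(v,v)}\le\frac{\mathscr{D}_{h,k}(u,v)}{\partial_1\mathscr{D}_{h,k}(v,v)}.$$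
   Context: A function $M:I^d\to I$ is a $d$-variable mean on $I$ if $\min(\pmb{x})\le M(\pmb{x})\le\max(\pmb{x})$ for all $\pmb{x}\in I^d$. For continuous $f,g:I\to\mathbb{R}$ put $\mathscr{D}_{f,g}(x,y):=f(x)g(y)-f(y)g(x)$; $\partial_1$ is differentiation in the first argument, so $\partial_1\mathscr{D}_{f,g}(x,x)=f'(x)g(x)-f(x)g'(x)$. $(f,g)$ is a Chebyshev system on $I$ if $\mathscr{D}_{f,g}(x,y)\ne0$ for all distinct $x,y\in I$. $\mathscr{C}_1(I)$ is the class of Chebyshev systems $(f,g)$ on $I$ with $f,g$ continuously differentiable and $\partial_1\mathscr{D}_{f,g}(x,x)\ne0$ for all $x\in I$. For a topological space $T$ with its Borel $\sigma$-algebra, $m:I^d\times T\to I$ is a continuous family of $d$-variable means on $I$ if $m(\cdot,t)$ is a $d$-variable mean on $I$ for every $t\in T$ and $m(\pmb{x},\cdot)$ is continuous on $T$ for every $\pmb{x}\in I^d$. Put $\underline{m}(\pmb{x}):=\inf_{t\in T}m(\pmb{x},t)$ and $\overline{m}(\pmb{x}):=\sup_{t\in T}m(\pmb{x},t)$. For a Chebyshev system $(f,g)$ on $I$ and a Borel probability measure $\mu$ on $T$, $M_{f,g,m;\mu}(\pmb{x})$ denotes the unique $y\in[\underline{m}(\pmb{x}),\overline{m}(\pmb{x})]$ with $\int_T\mathscr{D}_{f,g}(m(\pmb{x},t),y)\,d\mu(t)=0$ (such a $y$ exists and is unique). $\delta_t$ is the Dirac measure at $t$. A null sequence is a sequence converging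 to $0$. *)

theory Defs
  imports "HOL-Probability.Probability"
begin

definition cube :: "real set \<Rightarrow> (real ^ 'n) set" where
  "cube I = {x. \<forall>i. x $ i \<in> I}"

definition is_mean :: "real set \<Rightarrow> (real ^ 'n \<Rightarrow> real) \<Rightarrow> bool" where
  "is_mean I M \<longleftrightarrow>
     (\<forall>x \<in> cube I. M x \<in> I \<and> Min (range (($) x)) \<le> M x \<and> M x \<le> Max (range (($) x)))"

definition DD :: "(real \<Rightarrow> real) \<Rightarrow> (real \<Rightarrow> real) \<Rightarrow> real \<Rightarrow> real \<Rightarrow> real" where
  "DD f g x y = f x * g y - f y * g x"

definition d1_DD :: "(real \<Rightarrow> real) \<Rightarrow> (real \<Rightarrow> real) \<Rightarrow> real \<Rightarrow> real \<Rightarrow> real" where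
  "d1_DD f g x y = deriv (\<lambda>s. DD f g s y) x"

definition chebyshev_system :: "real set \<Rightarrow> (real \<Rightarrow> real) \<Rightarrow> (real \<Rightarrow> real) \<Rightarrow> bool" where
  "chebyshev_system I f g \<longleftrightarrow>
     continuous_on I f \<and> continuous_on I g \<and>
     (\<forall>x \<in> I. \<forall>y \<in> I. x \<noteq> y \<longrightarrow> DD f g x y \<noteq> 0)"

definition chebyshev_C1 :: "real set \<Rightarrow> (real \<Rightarrow> real) \<Rightarrow> (real \<Rightarrow> real) \<Rightarrow> bool" where
  "chebyshev_C1 I f g \<longleftrightarrow>
     chebyshev_system I f g \<and> f C1_differentiable_on I \<and> g C1_differentiable_on I \<and>
     (\<forall>x \<in> I. d1_DD f g x x \<noteq> 0)"

text \<open>The topological space \<open>T\<close> is a subset of a topological type, with its subspace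
  topology. Its Borel sets are the sets of \<^term>\<open>restrict_space borel T\<close>, as trace and
  generation of sigma-algebras commute.\<close>

definition borel_prob_measure :: "'t::topological_space set \<Rightarrow> 't measure \<Rightarrow> bool" where
  "borel_prob_measure T \<mu> \<longleftrightarrow>
     prob_space \<mu> \<and> sets \<mu> = sets (restrict_space borel T)"

definition continuous_family_of_means ::
  "real set \<Rightarrow> 't::topological_space set \<Rightarrow> (real ^ 'n \<Rightarrow> 't \<Rightarrow> real) \<Rightarrow> bool" where
  "continuous_family_of_means I T m \<longleftrightarrow>
     (\<forall>t \<in> T. is_mean I (\<lambda>x. m x t)) \<and> (\<forall>x \<in> cube I. continuous_on T (m x))"

definition m_low :: "'t set \<Rightarrow> (real ^ 'n \<Rightarrow> 't \<Rightarrow> real) \<Rightarrow> real ^ 'n \<Rightarrow> real" where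
  "m_low T m x = (INF t \<in> T. m x t)"

definition m_up :: "'t set \<Rightarrow> (real ^ 'n \<Rightarrow> 't \<Rightarrow> real) \<Rightarrow> real ^ 'n \<Rightarrow> real" where
  "m_up T m x = (SUP t \<in> T. m x t)"

definition gen_mean ::
  "'t set \<Rightarrow> (real \<Rightarrow> real) \<Rightarrow> (real \<Rightarrow> real) \<Rightarrow> (real ^ 'n \<Rightarrow> 't \<Rightarrow> real) \<Rightarrow> 't measure
     \<Rightarrow> real ^ 'n \<Rightarrow> real" where
  "gen_mean T f g m \<mu> x =
     (THE y. y \<in> {m_low T m x..m_up T m x} \<and> (LINT t|\<mu>. DD f g (m x t) y) = 0)"

definition dirac :: "'t::topological_space set \<Rightarrow> 't \<Rightarrow> 't measure" where
  "dirac T t = return (restrict_space borel T) t"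

text \<open>The convex combination \<open>(1 - c) \<mu> + c \<nu>\<close>, for \<open>0 \<le> c \<le> 1\<close> and measures with the same
  measurable sets.\<close>

definition mix_measure :: "real \<Rightarrow> 't measure \<Rightarrow> 't measure \<Rightarrow> 't measure" where
  "mix_measure c \<mu> \<nu> =
     measure_of (space \<mu>) (sets \<mu>)
       (\<lambda>A. ennreal (1 - c) * emeasure \<mu> A + ennreal c * emeasure \<nu> A)"

lemma sets_mix_measure [simp]: "sets (mix_measure c \<mu> \<nu>) = sets \<mu>"
  by (simp add: mix_measure_def)

lemma emeasure_mix_measure:
  assumes "sets \<nu> = sets \<mu>" and "A \<in> sets \<mu>"
  shows "emeasure (mix_measure c \<mu> \<nu>) A = ennreal (1 - c) * emeasure \<mu> A + ennreal c * emeasure \<nu> A"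
proof (rule emeasure_measure_of[OF mix_measure_def])
  show "countably_additive (sets (mix_measure c \<mu> \<nu>))
          (\<lambda>A. ennreal (1 - c) * emeasure \<mu> A + ennreal c * emeasure \<nu> A)"
    using assms(1)
    by (auto simp: countably_additive_def suminf_add[symmetric] suminf_emeasure)
qed (use assms in \<open>auto simp: positive_def sets.sets_into_space dest: sets.sets_into_space\<close>)

definition U_set ::
  "real set \<Rightarrow> 't set \<Rightarrow> (real ^ 'n \<Rightarrow> 't \<Rightarrow> real) \<Rightarrow> (real \<times> real) set" where
  "U_set I T m =
     {(u, v). \<exists>x \<in> cube I. u \<in> {m_low T m x..m_up T m x} \<and> v \<in> {m_low T m x..m_up T m x}}"

end

theory Submission
  imports Defs
begin

text \<open>Write \<open>N\<close> for \<open>D(u, v)\<close> divided by its first partial derivative at \<open>(v, v)\<close>. It has the sign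
  of \<open>u - v\<close>, and the generalized mean \<open>y\<close> is the unique sign change, from \<open>+\<close> to \<open>-\<close>, of
  \<open>w \<mapsto> \<integral> N(m(x, t), w) d\<mu>(t)\<close>. Hence comparing means amounts to comparing the signs of these
  integrals, and (iii) gives (i) by integrating. Conversely let \<open>y\<^sub>j\<close> be the \<open>(f, g)\<close>-mean of
  \<open>(1 - \<gamma>\<^sub>j)\<close> times the Dirac measure at \<open>t\<^sub>0\<close> plus \<open>\<gamma>\<^sub>j\<close> times that at \<open>t\<close>, where \<open>m(x, t\<^sub>0) = v\<close> and
  \<open>m(x, t) = u\<close>. Eliminating \<open>\<gamma>\<^sub>j\<close> between the equation for \<open>y\<^sub>j\<close> and the inequality from (ii) leaves
  \<open>R\<^sub>j N\<^sub>f\<^sub>,\<^sub>g(u, y\<^sub>j) \<le> N\<^sub>h\<^sub>,\<^sub>k(u, y\<^sub>j)\<close> with \<open>R\<^sub>j = N\<^sub>h\<^sub>,\<^sub>k(v, y\<^sub>j) / N\<^sub>f\<^sub>,\<^sub>g(v, y\<^sub>j)\<close>. As \<open>y\<^sub>j\<close> tends to \<open>v\<close>,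
  \<open>R\<^sub>j\<close> tends to 1, which is (iii).\<close>

section \<open>The normalized determinant of a Chebyshev system and its sign\<close>

definition nD :: "(real \<Rightarrow> real) \<Rightarrow> (real \<Rightarrow> real) \<Rightarrow> real \<Rightarrow> real \<Rightarrow> real" where
  "nD f g u v = DD f g u v / d1_DD f g v v"

locale C1_chebyshev_pair =
  fixes I :: "real set" and f g :: "real \<Rightarrow> real"
  assumes open_I: "open I" and interval_I: "is_interval I"
    and chebyshev: "chebyshev_C1 I f g"
begin

lemma continuous_f: "continuous_on I f" and continuous_g: "continuous_on I g"
  and DD_nonzero: "\<lbrakk>x \<in> I; y \<in> I; x \<noteq> y\<rbrakk> \<Longrightarrow> DD f g x y \<noteq> 0"
  and d1_DD_nonzero: "x \<in> I \<Longrightarrow> d1_DD f g x x \<noteq> 0"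
  using chebyshev by (auto simp: chebyshev_C1_def chebyshev_system_def)

lemma derivatives:
  obtains f' g' where
    "\<And>x. x \<in> I \<Longrightarrow> (f has_real_derivative f' x) (at x)" "continuous_on I f'"
    "\<And>x. x \<in> I \<Longrightarrow> (g has_real_derivative g' x) (at x)" "continuous_on I g'"
proof -
  have "f C1_differentiable_on I" "g C1_differentiable_on I"
    using chebyshev by (auto simp: chebyshev_C1_def)
  then show ?thesis
    using that unfolding C1_differentiable_on_def has_real_derivative_iff_has_vector_derivative
    by metis
qed

lemma DD_has_derivative:
  assumes "x \<in> I"
  shows "((\<lambda>s. DD f g s y) has_real_derivative d1_DD f g x y) (at x)"
proof -
  obtain f' g' where "(f has_real_derivative f' x) (at x)" "(g has_real_derivative g' x) (at x)"
    using derivatives assms by metis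
  then have "((\<lambda>s. DD f g s y) has_real_derivative f' x * g y - f y * g' x) (at x)"
    unfolding DD_def by (auto intro!: derivative_eq_intros)
  then show ?thesis
    unfolding d1_DD_def by (metis DERIV_imp_deriv)
qed

lemma continuous_d1_DD: "continuous_on I (\<lambda>v. d1_DD f g v v)"
proof -
  obtain f' g' where f': "\<And>x. x \<in> I \<Longrightarrow> (f has_real_derivative f' x) (at x)" "continuous_on I f'"
    and g': "\<And>x. x \<in> I \<Longrightarrow> (g has_real_derivative g' x) (at x)" "continuous_on I g'"
    using derivatives by blast
  have "d1_DD f g v v = f' v * g v - f v * g' v" if "v \<in> I" for v
    unfolding d1_DD_def DD_def
    by (rule DERIV_imp_deriv) (auto intro!: derivative_eq_intros f' g' that)
  moreover have "continuous_on I (\<lambda>v. f' v * g v - f v * g' v)"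
    by (intro continuous_intros f' g' continuous_f continuous_g)
  ultimately show ?thesis
    by (simp cong: continuous_on_cong)
qed

lemma continuous_nD: "continuous_on I (nD f g u)"
  unfolding nD_def[abs_def] DD_def
  by (intro continuous_intros continuous_f continuous_g continuous_d1_DD ballI d1_DD_nonzero)

lemma nD_self [simp]: "nD f g v v = 0"
  by (simp add: nD_def DD_def)

lemma nD_eq_0_iff: "v \<in> I \<Longrightarrow> nD f g u v = 0 \<longleftrightarrow> DD f g u v = 0"
  using d1_DD_nonzero by (simp add: nD_def)

lemma DD_quotient_tendsto:
  assumes "v \<in> I"
  shows "((\<lambda>u. DD f g u v / (u - v)) \<longlongrightarrow> d1_DD f g v v) (at v)"
  using DD_has_derivative[OF assms, of v] by (simp add: has_field_derivative_iff DD_def)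

text \<open>The difference quotient of \<open>DD f g\<close> at the diagonal, completed by the derivative, is a
  continuous function without zeros on an interval, so it has constant sign.\<close>

lemma nD_quotient_pos:
  assumes "u \<in> I" "v \<in> I" "u \<noteq> v"
  shows "nD f g u v / (u - v) > 0"
proof -
  \<comment> \<open>The normalization by \<open>d1_DD f g v v\<close> makes 1 the limit of the
    quotient at \<open>v\<close>; this value both completes \<open>q\<close> continuously and
    settles that its constant sign is positive.\<close>
  define q where "q u = (if u = v then 1 else nD f g u v / (u - v))" for u
  have "isCont q w" if "w \<in> I" for w
  proof (cases "w = v")
    case True
    have "((\<lambda>u. (DD f g u v / (u - v)) / d1_DD f g v v) \<longlongrightarrow> d1_DD f g v v / d1_DD f g v v) (at v)"
      by (intro tendsto_intros DD_quotient_tendsto d1_DD_nonzero assms)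
    then have "(q \<longlongrightarrow> 1) (at v)"
      using d1_DD_nonzero[OF assms(2)]
      by (rule_tac Lim_transform_eventually)
        (auto simp: q_def nD_def eventually_at_filter divide_simps)
    then show ?thesis
      using True by (simp add: isCont_def q_def)
  next
    case False
    have "isCont (\<lambda>u. nD f g u v / (u - v)) w"
      using that open_I continuous_f continuous_g False
      unfolding nD_def DD_def
      by (intro continuous_intros) (auto simp: continuous_on_eq_continuous_at d1_DD_nonzero assms)
    moreover have "\<forall>\<^sub>F u in nhds w. nD f g u v / (u - v) = q u"
      using t1_space_nhds[OF False] by eventually_elim (simp add: q_def)
    ultimately show ?thesis
      using isCont_cong by metis
  qed
  then have "continuous_on I q"
    by (simp add: continuous_at_imp_continuous_on)
  then have conn: "is_interval (q ` I)"
    using interval_I by (simp add: is_interval_connected_1 connected_continuous_image)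
  have nz: "q w \<noteq> 0" if "w \<in> I" for w
    using that assms DD_nonzero[of w v] by (auto simp: q_def nD_eq_0_iff)
  have "q u > 0"
  proof (rule ccontr)
    assume "\<not> q u > 0"
    moreover have "q v = 1" by (simp add: q_def)
    ultimately have "0 \<in> q ` I"
      using mem_is_interval_1_I[OF conn, of "q u" "q v" 0] assms by auto
    then show False using nz by auto
  qed
  then show ?thesis using assms by (simp add: q_def)
qed

lemma nD_less_0: "\<lbrakk>u \<in> I; v \<in> I; u < v\<rbrakk> \<Longrightarrow> nD f g u v < 0"
  and nD_greater_0: "\<lbrakk>u \<in> I; v \<in> I; v < u\<rbrakk> \<Longrightarrow> nD f g u v > 0"
  using nD_quotient_pos[of u v] by (auto simp: zero_less_divide_iff)

end

section \<open>The generalized mean of one random variable \<open>X\<close>, standing for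
  \<open>m x\<close> at a fixed \<open>x\<close>\<close>

locale C1_chebyshev_rv = C1_chebyshev_pair I f g + prob_space M
  for I f g and M :: "'t measure" +
  fixes X :: "'t \<Rightarrow> real" and a b :: real
  assumes X_measurable [measurable]: "X \<in> borel_measurable M"
    and X_range: "t \<in> space M \<Longrightarrow> X t \<in> {a..b}"
    and ab: "{a..b} \<subseteq> I"
begin

text \<open>\<open>X\<close> takes its values in a compact interval inside \<open>I\<close>, on
  which \<phi> is bounded. As \<phi> is continuous only on \<open>I\<close>, measurability goes
  through the restriction of \<phi> to \<open>{a..b}\<close>.\<close>

lemma integrable_comp:
  assumes "continuous_on I \<phi>"
  shows "integrable M (\<lambda>t. \<phi> (X t) :: real)"
proof -
  have cont: "continuous_on {a..b} \<phi>"
    using assms ab continuous_on_subset by blast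
  then obtain B where "\<And>x. x \<in> {a..b} \<Longrightarrow> norm (\<phi> x) \<le> B"
    by (metis bounded_iff compact_Icc compact_continuous_image compact_imp_bounded imageI)
  moreover have "\<phi> \<in> borel_measurable (restrict_space borel {a..b})"
    using cont by (rule borel_measurable_continuous_on_restrict)
  then have "(\<lambda>t. \<phi> (X t)) \<in> borel_measurable M"
    by (rule measurable_compose[rotated]) (auto intro!: measurable_restrict_space2 X_range)
  ultimately show ?thesis
    using X_range by (intro integrable_const_bound[where B=B]) auto
qed

definition psi :: "real \<Rightarrow> real" where
  "psi y = (LINT t|M. nD f g (X t) y)"

text \<open>The determinant separates its two arguments, so \<open>y\<close> leaves the integral.
  Continuity of \<open>psi\<close> then needs no limit under the integral sign, and its zeros are
  governed by linear equations in two numbers.\<close>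

lemma integral_DD:
  "(LINT t|M. DD f g (X t) y) = (LINT t|M. f (X t)) * g y - f y * (LINT t|M. g (X t))"
  unfolding DD_def using integrable_comp[OF continuous_f] integrable_comp[OF continuous_g] by simp

lemma psi_eq: "psi y = (LINT t|M. DD f g (X t) y) / d1_DD f g y y"
  by (simp add: psi_def nD_def)

lemma integrable_nD: "integrable M (\<lambda>t. nD f g (X t) y)"
  unfolding nD_def DD_def
  using integrable_comp[OF continuous_f] integrable_comp[OF continuous_g] by simp

lemma psi_eq_0_iff: "y \<in> I \<Longrightarrow> psi y = 0 \<longleftrightarrow> (LINT t|M. DD f g (X t) y) = 0"
  using d1_DD_nonzero by (simp add: psi_eq)

lemma continuous_psi: "continuous_on I psi"
  unfolding psi_eq[abs_def] integral_DD
  by (intro continuous_intros continuous_f continuous_g continuous_d1_DD ballI d1_DD_nonzero)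

lemma a_le_b: "a \<le> b"
  using X_range not_empty by fastforce

text \<open>Since \<open>X\<close> stays above \<open>a\<close>, the integrand is nonnegative.
  Together with the opposite sign at \<open>b\<close> this prepares the intermediate value
  theorem.\<close>

lemma psi_a: "psi a \<ge> 0"
  unfolding psi_def
proof (rule integral_nonneg_AE, intro AE_I2)
  fix t assume "t \<in> space M"
  then show "0 \<le> nD f g (X t) a"
    using X_range[of t] ab nD_greater_0[of "X t" a] by (cases "X t = a") force+
qed

lemma psi_b: "psi b \<le> 0"
proof -
  have "0 \<le> (LINT t|M. - nD f g (X t) b)"
  proof (rule integral_nonneg_AE, intro AE_I2)
    fix t assume "t \<in> space M"
    then show "0 \<le> - nD f g (X t) b"
      using X_range[of t] ab nD_less_0[of "X t" b] by (cases "X t = b") (auto simp: subset_iff less_le)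
  qed
  then show ?thesis by (simp add: psi_def)
qed

text \<open>A nonnegative integrand with integral zero vanishes almost everywhere, and on
  \<open>I\<close> the function \<open>nD f g\<close> vanishes only on the diagonal.\<close>

lemma AE_eq_a:
  assumes "psi a = 0"
  shows "AE t in M. X t = a"
proof -
  have *: "0 \<le> nD f g (X t) a" "nD f g (X t) a = 0 \<Longrightarrow> X t = a" if "t \<in> space M" for t
    using X_range[OF that] ab nD_greater_0[of "X t" a] by (cases "X t = a"; force)+
  have "AE t in M. nD f g (X t) a = 0"
    using assms * integral_nonneg_eq_0_iff_AE[OF integrable_nD[of a]] by (simp add: psi_def)
  with AE_space show ?thesis
    by eventually_elim (use * in auto)
qed

text \<open>By Cramer's rule two distinct zeros of \<open>psi\<close> force the integrals of \<open>f \<circ> X\<close> and \<open>g \<circ> X\<close> to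
  vanish, hence \<open>psi\<close> to vanish identically and \<open>X\<close> to be a.e. constant.\<close>

lemma psi_root_unique:
  assumes y: "y \<in> {a..b}" "psi y = 0" and z: "z \<in> {a..b}" "psi z = 0"
  shows "y = z"
proof (rule ccontr)
  assume "y \<noteq> z"
  define F G where "F = (LINT t|M. f (X t))" and "G = (LINT t|M. g (X t))"
  have "y \<in> I" "z \<in> I" using y z ab by auto
  then have eqs: "F * g y = f y * G" "F * g z = f z * G"
    using y z by (simp_all add: psi_eq_0_iff integral_DD F_def G_def)
  have "F * DD f g y z = 0" "G * DD f g y z = 0"
    using eqs unfolding DD_def by algebra+
  then have FG: "F = 0" "G = 0"
    using DD_nonzero[OF \<open>y \<in> I\<close> \<open>z \<in> I\<close> \<open>y \<noteq> z\<close>] by auto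
  then have "psi a = 0"
    by (simp add: psi_eq integral_DD F_def[symmetric] G_def[symmetric])
  then have X: "AE t in M. X t = a" by (rule AE_eq_a)
  \<comment> \<open>The contradiction sits at \<open>b\<close>: the a.e. constant value
    \<open>a\<close> gives \<open>psi b = nD f g a b\<close>, which is negative since
    \<open>a < b\<close>, whereas \<open>F = G = 0\<close> gives \<open>psi b = 0\<close>.\<close>
  have "psi b = (LINT t|M. nD f g a b)"
    unfolding psi_def
  proof (rule integral_cong_AE)
    show "AE t in M. nD f g (X t) b = nD f g a b"
      using X by eventually_elim simp
  qed (use integrable_nD in auto)
  then have "psi b = nD f g a b"
    by (simp add: prob_space)
  moreover have "psi b = 0"
    using FG by (simp add: psi_eq integral_DD F_def[symmetric] G_def[symmetric])
  moreover have "a < b" using y z \<open>y \<noteq> z\<close> by auto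
  ultimately show False using nD_less_0[of a b] ab by (simp add: subset_iff)
qed

lemma psi_root_exists: "\<exists>y\<in>{a..b}. psi y = 0"
  using IVT2'[of psi b 0 a] psi_a psi_b a_le_b continuous_on_subset[OF continuous_psi ab] by auto

text \<open>A value of \<open>psi\<close> at \<open>w\<close> of known sign yields, with the sign at
  \<open>a\<close> or \<open>b\<close>, a root on the corresponding side of \<open>w\<close>; by
  uniqueness that root is \<open>y\<close>. This turns comparisons with the mean into signs of
  integrals.\<close>

lemma le_root_iff:
  assumes y: "y \<in> {a..b}" "psi y = 0" and w: "w \<in> {a..b}"
  shows "w \<le> y \<longleftrightarrow> 0 \<le> psi w"
proof
  assume "w \<le> y"
  show "0 \<le> psi w"
  proof (rule ccontr)
    assume neg: "\<not> 0 \<le> psi w"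
    then obtain z where "a \<le> z" "z \<le> w" "psi z = 0"
      using IVT2'[of psi w 0 a] psi_a w ab continuous_on_subset[OF continuous_psi, of "{a..w}"] by force
    then have "z = y" using psi_root_unique[of z y] y w by auto
    then show False using \<open>w \<le> y\<close> \<open>z \<le> w\<close> \<open>psi z = 0\<close> neg by auto
  qed
next
  assume nonneg: "0 \<le> psi w"
  then obtain z where "w \<le> z" "z \<le> b" "psi z = 0"
    using IVT2'[of psi b 0 w] psi_b w ab continuous_on_subset[OF continuous_psi, of "{w..b}"] by force
  then show "w \<le> y" using psi_root_unique[of z y] y w by auto
qed

lemma
  assumes "X = m x" "a = m_low T m x" "b = m_up T m x"
  shows gen_mean_mem: "gen_mean T f g m M x \<in> {a..b}"
    and psi_gen_mean: "psi (gen_mean T f g m M x) = 0"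
proof -
  have "\<exists>!y. y \<in> {a..b} \<and> (LINT t|M. DD f g (X t) y) = 0"
    using psi_root_exists psi_root_unique psi_eq_0_iff ab by (metis subsetD)
  from theI'[OF this] have *: "gen_mean T f g m M x \<in> {a..b}"
    "(LINT t|M. DD f g (X t) (gen_mean T f g m M x)) = 0"
    unfolding gen_mean_def assms by blast+
  then show "gen_mean T f g m M x \<in> {a..b}" "psi (gen_mean T f g m M x) = 0"
    using psi_eq_0_iff ab by blast+
qed

end

section \<open>Two-point measures\<close>

text \<open>Seen as the image of a Bernoulli law, the mixture inherits total mass one and its
  integration formula from the general facts on image measures.\<close>

lemma mix_dirac_eq_distr:
  assumes c: "0 \<le> c" "c \<le> 1" and t: "t0 \<in> T" "t \<in> T"
  shows "mix_measure c (dirac T t0) (dirac T t)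
    = distr (measure_pmf (bernoulli_pmf c)) (restrict_space borel T) (\<lambda>x. if x then t else t0)"
    (is "?L = distr _ _ ?h")
proof (rule measure_eqI)
  fix A assume "A \<in> sets ?L"
  then have A: "A \<in> sets (restrict_space borel T)" by (simp add: dirac_def)
  have h: "?h \<in> measure_pmf (bernoulli_pmf c) \<rightarrow>\<^sub>M restrict_space borel T"
    using t by (auto simp: space_restrict_space)
  have "emeasure (distr (measure_pmf (bernoulli_pmf c)) (restrict_space borel T) ?h) A
      = (\<integral>\<^sup>+x. indicator A x \<partial>distr (measure_pmf (bernoulli_pmf c)) (restrict_space borel T) ?h)"
    using A by simp
  also have "\<dots> = (\<integral>\<^sup>+x. indicator A (?h x) \<partial>measure_pmf (bernoulli_pmf c))"
    using A h by (intro nn_integral_distr) auto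
  also have "\<dots> = indicator A t * ennreal c + indicator A t0 * ennreal (1 - c)"
    using c by (subst nn_integral_bernoulli_pmf) auto
  also have "\<dots> = emeasure ?L A"
    using A by (subst emeasure_mix_measure) (auto simp: dirac_def mult.commute add.commute)
  finally show "emeasure ?L A = emeasure (distr (measure_pmf (bernoulli_pmf c)) (restrict_space borel T) ?h) A" ..
qed (simp add: dirac_def)

lemma borel_prob_measure_mix_dirac:
  assumes "0 \<le> c" "c \<le> 1" "t0 \<in> T" "t \<in> T"
  shows "borel_prob_measure T (mix_measure c (dirac T t0) (dirac T t))"
  unfolding borel_prob_measure_def mix_dirac_eq_distr[OF assms]
  using assms by (auto intro!: prob_space.prob_space_distr prob_space_measure_pmf simp: space_restrict_space)

lemma integral_mix_dirac:
  fixes \<phi> :: "'t::topological_space \<Rightarrow> real"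
  assumes "0 \<le> c" "c \<le> 1" "t0 \<in> T" "t \<in> T" "\<phi> \<in> borel_measurable (restrict_space borel T)"
  shows "(LINT s|mix_measure c (dirac T t0) (dirac T t). \<phi> s) = (1 - c) * \<phi> t0 + c * \<phi> t"
  unfolding mix_dirac_eq_distr[OF assms(1-4)]
  using assms by (subst integral_distr) (auto simp: space_restrict_space)

text \<open>The continuous image of a compact connected space is a compact interval, so its
  endpoints are the infimum and supremum. Consequently every pair in \<open>U_set I T m\<close> is
  realized as values of \<open>m x\<close> at two points of \<open>T\<close>.\<close>

lemma mean_family_range:
  assumes T: "compact T" "connected T" "T \<noteq> {}"
    and m: "continuous_family_of_means I T m" and x: "x \<in> cube I"
  shows "m x ` T = {m_low T m x..m_up T m x}" and "{m_low T m x..m_up T m x} \<subseteq> I"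
proof -
  have "continuous_on T (m x)"
    using m x by (auto simp: continuous_family_of_means_def)
  then have "compact (m x ` T)" "connected (m x ` T)"
    using T by (auto intro: compact_continuous_image connected_continuous_image)
  then obtain a b where ab: "m x ` T = {a..b}"
    using connected_compact_interval_1 by (metis box_real(2))
  moreover from this have "a \<le> b"
    using T by (metis atLeastatMost_empty_iff image_is_empty)
  ultimately have "m_low T m x = a" "m_up T m x = b"
    by (simp_all add: m_low_def m_up_def)
  with ab show eq: "m x ` T = {m_low T m x..m_up T m x}" by simp
  show "{m_low T m x..m_up T m x} \<subseteq> I"
    unfolding eq[symmetric] using m x by (auto simp: continuous_family_of_means_def is_mean_def)
qed

section \<open>Generalized means of a continuous family, and their limit along two-point
  measures\<close>

locale C1_chebyshev_family = C1_chebyshev_pair I f g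
  for I f g and T :: "'t::topological_space set" and m :: "real ^ 'n \<Rightarrow> 't \<Rightarrow> real" +
  assumes T: "compact T" "connected T" "T \<noteq> {}"
    and m: "continuous_family_of_means I T m"
begin

lemma m_measurable: "x \<in> cube I \<Longrightarrow> m x \<in> borel_measurable (restrict_space borel T)"
  using m by (auto simp: continuous_family_of_means_def intro: borel_measurable_continuous_on_restrict)

lemma C1_chebyshev_rv_mean:
  assumes "borel_prob_measure T \<mu>" and x: "x \<in> cube I"
  shows "C1_chebyshev_rv I f g \<mu> (m x) (m_low T m x) (m_up T m x)"
proof -
  interpret prob_space \<mu>
    using assms by (simp add: borel_prob_measure_def)
  have sets: "sets \<mu> = sets (restrict_space borel T)"
    using assms by (simp add: borel_prob_measure_def)
  then have "space \<mu> = T"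
    by (auto dest: sets_eq_imp_space_eq simp: space_restrict_space)
  then show ?thesis
    using mean_family_range[OF T m x] m_measurable[OF x] sets
    by unfold_locales (auto simp: measurable_cong_sets[OF sets refl])
qed

lemma gen_mean_in_range:
  assumes "borel_prob_measure T \<mu>" and "x \<in> cube I"
  shows "gen_mean T f g m \<mu> x \<in> {m_low T m x..m_up T m x}"
  by (rule C1_chebyshev_rv.gen_mean_mem[OF C1_chebyshev_rv_mean[OF assms]]) (rule refl)+

lemma integral_nD_gen_mean:
  assumes "borel_prob_measure T \<mu>" and "x \<in> cube I"
  shows "(LINT t|\<mu>. nD f g (m x t) (gen_mean T f g m \<mu> x)) = 0"
  using C1_chebyshev_rv.psi_gen_mean[OF C1_chebyshev_rv_mean[OF assms] refl refl refl]
  by (simp add: C1_chebyshev_rv.psi_def[OF C1_chebyshev_rv_mean[OF assms]])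

lemma le_gen_mean_iff:
  assumes "borel_prob_measure T \<mu>" and "x \<in> cube I" and "w \<in> {m_low T m x..m_up T m x}"
  shows "w \<le> gen_mean T f g m \<mu> x \<longleftrightarrow> 0 \<le> (LINT t|\<mu>. nD f g (m x t) w)"
  using C1_chebyshev_rv.le_root_iff[OF C1_chebyshev_rv_mean[OF assms(1,2)]
      gen_mean_in_range[OF assms(1,2)] _ assms(3)] integral_nD_gen_mean[OF assms(1,2)]
  by (simp add: C1_chebyshev_rv.psi_def[OF C1_chebyshev_rv_mean[OF assms(1,2)]])

lemma integral_nD_mix_dirac:
  assumes x: "x \<in> cube I" and "0 \<le> c" "c \<le> 1" "t0 \<in> T" "t \<in> T"
  shows "(LINT s|mix_measure c (dirac T t0) (dirac T t). nD f g (m x s) w)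
    = (1 - c) * nD f g (m x t0) w + c * nD f g (m x t) w"
proof (rule integral_mix_dirac[OF assms(2-)])
  have cont: "continuous_on T (m x)" "m x ` T \<subseteq> I"
    using m x mean_family_range[OF T m x] by (auto simp: continuous_family_of_means_def)
  have "continuous_on T (\<lambda>s. f (m x s))" "continuous_on T (\<lambda>s. g (m x s))"
    using continuous_on_compose2[OF continuous_f cont] continuous_on_compose2[OF continuous_g cont]
    by auto
  then have "continuous_on T (\<lambda>s. nD f g (m x s) w)"
    unfolding nD_def DD_def divide_inverse by (intro continuous_intros)
  then show "(\<lambda>s. nD f g (m x s) w) \<in> borel_measurable (restrict_space borel T)"
    by (rule borel_measurable_continuous_on_restrict)
qed

text \<open>For fixed \<open>w\<close> the integral of \<open>nD f g (m x s) w\<close> tends to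
  \<open>nD f g (m x t0) w\<close>, whose sign tells on which side of \<open>w\<close> the point
  \<open>m x t0\<close> lies. By the sign criterion the means eventually lie on the same
  side.\<close>

lemma gen_mean_mix_dirac_tendsto:
  assumes x: "x \<in> cube I" and t: "t0 \<in> T" "t \<in> T"
    and \<gamma>: "\<gamma> \<longlonglongrightarrow> 0" "\<And>j. 0 < \<gamma> j \<and> \<gamma> j \<le> 1"
  shows "(\<lambda>j. gen_mean T f g m (mix_measure (\<gamma> j) (dirac T t0) (dirac T t)) x) \<longlonglongrightarrow> m x t0"
    (is "?y \<longlonglongrightarrow> _")
proof (rule order_tendstoI)
  have \<gamma>': "0 \<le> \<gamma> j" "\<gamma> j \<le> 1" for j using \<gamma>(2)[of j] by auto
  note bpm = borel_prob_measure_mix_dirac[OF \<gamma>' t]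
  have bounds: "m_low T m x \<le> ?y j" "?y j \<le> m_up T m x" for j
    using gen_mean_in_range[OF bpm x, of j] by auto
  note I = mean_family_range[OF T m x]
  have v: "m x t0 \<in> I" "m x t0 \<in> {m_low T m x..m_up T m x}" using I t by auto
  have lim: "(\<lambda>j. (1 - \<gamma> j) * nD f g (m x t0) w + \<gamma> j * nD f g (m x t) w) \<longlonglongrightarrow> nD f g (m x t0) w" for w
    by (rule tendsto_eq_intros \<gamma>(1) refl | simp)+
  show "\<forall>\<^sub>F j in sequentially. w < ?y j" if w: "w < m x t0" for w
  proof (cases "w < m_low T m x")
    case True
    then show ?thesis by (intro always_eventually allI less_le_trans[OF _ bounds(1)])
  next
    case False
    \<comment> \<open>The criterion only gives a weak inequality \<open>w' \<le> ?y j\<close>, so a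
      point strictly between \<open>w\<close> and the limit is used to obtain a strict one.\<close>
    define w' where "w' = (w + m x t0) / 2"
    have w': "w < w'" "w' < m x t0" "w' \<in> {m_low T m x..m_up T m x}"
      using False w v by (auto simp: w'_def)
    then have "nD f g (m x t0) w' > 0"
      using v I by (intro nD_greater_0) auto
    then have "\<forall>\<^sub>F j in sequentially. 0 < (1 - \<gamma> j) * nD f g (m x t0) w' + \<gamma> j * nD f g (m x t) w'"
      by (rule order_tendstoD[OF lim])
    then show ?thesis
    proof eventually_elim
      case (elim j)
      then have "w' \<le> ?y j"
        unfolding le_gen_mean_iff[OF bpm x w'(3)] integral_nD_mix_dirac[OF x \<gamma>' t] by simp
      then show ?case using w' by simp
    qed
  qed
  show "\<forall>\<^sub>F j in sequentially. ?y j < w" if w: "m x t0 < w" for w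
  proof (cases "m_up T m x < w")
    case True
    then show ?thesis by (intro always_eventually allI le_less_trans[OF bounds(2)])
  next
    case False
    \<comment> \<open>On this side the criterion is negated and already strict, so \<open>w\<close>
      itself serves.\<close>
    then have w': "w \<in> {m_low T m x..m_up T m x}" using w v by auto
    then have "nD f g (m x t0) w < 0"
      using v w I by (intro nD_less_0) auto
    then have "\<forall>\<^sub>F j in sequentially. (1 - \<gamma> j) * nD f g (m x t0) w + \<gamma> j * nD f g (m x t) w < 0"
      by (rule order_tendstoD[OF lim])
    then show ?thesis
    proof eventually_elim
      case (elim j)
      then have "\<not> w \<le> ?y j"
        unfolding le_gen_mean_iff[OF bpm x w'] integral_nD_mix_dirac[OF x \<gamma>' t] by simp
      then show ?case by simp
    qed
  qed
qed

end

section \<open>Comparison of two Chebyshev systems\<close>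

text \<open>By antisymmetry of the determinant the ratio equals one of difference quotients at
  \<open>v\<close>, each divided by the derivative at \<open>(y, y)\<close>. Continuity of that
  derivative on the diagonal makes numerator and denominator both tend to 1.\<close>

lemma nD_ratio_tendsto:
  assumes "C1_chebyshev_pair I f g" "C1_chebyshev_pair I h k" and v: "v \<in> I"
  shows "((\<lambda>y. nD h k v y / nD f g v y) \<longlongrightarrow> 1) (at v)"
proof -
  interpret fg: C1_chebyshev_pair I f g by fact
  interpret hk: C1_chebyshev_pair I h k by fact
  have d: "((\<lambda>y. d1_DD f g y y) \<longlongrightarrow> d1_DD f g v v) (at v)"
    "((\<lambda>y. d1_DD h k y y) \<longlongrightarrow> d1_DD h k v v) (at v)"
    using fg.continuous_d1_DD hk.continuous_d1_DD v fg.open_I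
    by (auto simp: continuous_on_eq_continuous_at isCont_def)
  note nz = fg.d1_DD_nonzero[OF v] hk.d1_DD_nonzero[OF v]
  have "((\<lambda>y. (DD h k y v / (y - v)) / d1_DD h k y y / ((DD f g y v / (y - v)) / d1_DD f g y y))
      \<longlongrightarrow> (d1_DD h k v v / d1_DD h k v v) / (d1_DD f g v v / d1_DD f g v v)) (at v)"
    by (intro tendsto_intros fg.DD_quotient_tendsto hk.DD_quotient_tendsto d v) (use nz in auto)
  moreover have "\<forall>\<^sub>F y in at v. (DD h k y v / (y - v)) / d1_DD h k y y
      / ((DD f g y v / (y - v)) / d1_DD f g y y) = nD h k v y / nD f g v y"
    using eventually_neq_at_within[of v v UNIV]
  proof eventually_elim
    case (elim y)
    have "DD h k v y = - DD h k y v" "DD f g v y = - DD f g y v"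
      by (simp_all add: DD_def)
    then show ?case using elim by (simp add: nD_def)
  qed
  ultimately show ?thesis
    using nz by (auto dest: Lim_transform_eventually)
qed

theorem theorem13:
  fixes I :: "real set"
    and f g h k :: "real \<Rightarrow> real"
    and T :: "'t::topological_space set"
    and m :: "real ^ 'n \<Rightarrow> 't \<Rightarrow> real"
  assumes "open I" and "is_interval I" and "I \<noteq> {}"
    and "CARD('n) \<ge> 2"
    and "chebyshev_C1 I f g" and "chebyshev_C1 I h k"
    and "compact T" and "connected T" and "T \<noteq> {}"
    and "continuous_family_of_means I T m"
  defines "assertion_i \<equiv>
      (\<forall>\<mu>. borel_prob_measure T \<mu> \<longrightarrow>
         (\<forall>x \<in> cube I. gen_mean T f g m \<mu> x \<le> gen_mean T h k m \<mu> x))"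
    and "assertion_ii \<equiv>
      (\<exists>\<gamma> :: nat \<Rightarrow> real.
         \<gamma> \<longlonglongrightarrow> 0 \<and> (\<forall>j. 0 < \<gamma> j \<and> \<gamma> j \<le> 1) \<and>
         (\<forall>t0 \<in> T. \<forall>t \<in> T. \<forall>j. \<forall>x \<in> cube I.
            gen_mean T f g m (mix_measure (\<gamma> j) (dirac T t0) (dirac T t)) x
              \<le> gen_mean T h k m (mix_measure (\<gamma> j) (dirac T t0) (dirac T t)) x))"
    and "assertion_iii \<equiv>
      (\<forall>(u, v) \<in> U_set I T m.
         DD f g u v / d1_DD f g v v \<le> DD h k u v / d1_DD h k v v)"
  shows "(assertion_i \<longleftrightarrow> assertion_ii) \<and> (assertion_ii \<longleftrightarrow> assertion_iii)"
proof -
  interpret fg: C1_chebyshev_family I f g T m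
    by unfold_locales (fact assms)+
  interpret hk: C1_chebyshev_family I h k T m
    by unfold_locales (fact assms)+
  note range = mean_family_range[OF fg.T fg.m]
  have "assertion_ii" if assertion_i
  proof -
    \<comment> \<open>Any null sequence in \<open>(0, 1]\<close> serves here, since (i) covers all
      the mixtures.\<close>
    have "(\<lambda>j. 1 / real (Suc j)) \<longlonglongrightarrow> 0"
      using LIMSEQ_inverse_real_of_nat by (simp add: inverse_eq_divide)
    moreover have "0 < 1 / real (Suc j) \<and> 1 / real (Suc j) \<le> 1" for j
      by simp
    moreover from this have "borel_prob_measure T (mix_measure (1 / real (Suc j)) (dirac T t0) (dirac T t))"
      if "t0 \<in> T" "t \<in> T" for j t0 t
      using that by (intro borel_prob_measure_mix_dirac) auto
    ultimately show ?thesis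
      using that unfolding assertion_i_def assertion_ii_def
      by (intro exI[of _ "\<lambda>j. 1 / real (Suc j)"]) blast
  qed
  moreover have "assertion_iii" if ii: assertion_ii
  proof -
    obtain \<gamma> :: "nat \<Rightarrow> real" where \<gamma>: "\<gamma> \<longlonglongrightarrow> 0" "\<And>j. 0 < \<gamma> j \<and> \<gamma> j \<le> 1"
      and le: "\<And>t0 t j x. \<lbrakk>t0 \<in> T; t \<in> T; x \<in> cube I\<rbrakk> \<Longrightarrow>
        gen_mean T f g m (mix_measure (\<gamma> j) (dirac T t0) (dirac T t)) x
          \<le> gen_mean T h k m (mix_measure (\<gamma> j) (dirac T t0) (dirac T t)) x"
      using ii unfolding assertion_ii_def by blast
    have "nD f g u v \<le> nD h k u v"
      if x: "x \<in> cube I" and uv: "u \<in> {m_low T m x..m_up T m x}" "v \<in> {m_low T m x..m_up T m x}"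
      for u v x
    proof (cases "u = v")
      case True
      then show ?thesis by simp
    next
      case False
      obtain t t0 where t: "t0 \<in> T" "t \<in> T" and tu: "m x t = u" and tv: "m x t0 = v"
      proof -
        have "u \<in> m x ` T" "v \<in> m x ` T"
          using uv unfolding range(1)[OF x] by simp_all
        then show ?thesis using that by blast
      qed
      have uvI: "u \<in> I" "v \<in> I" using uv range[OF x] by auto
      define y where "y j = gen_mean T f g m (mix_measure (\<gamma> j) (dirac T t0) (dirac T t)) x" for j
      have \<gamma>': "0 \<le> \<gamma> j" "\<gamma> j \<le> 1" for j using \<gamma>(2)[of j] by auto
      note bpm = borel_prob_measure_mix_dirac[OF \<gamma>' t]
      have yr: "y j \<in> {m_low T m x..m_up T m x}" for j
        unfolding y_def by (rule fg.gen_mean_in_range[OF bpm x])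
      then have yI: "y j \<in> I" for j using range[OF x] by blast
      \<comment> \<open>The equation defining \<open>y j\<close> as the \<open>(f, g)\<close>-mean.
        The next fact is the inequality of (ii), read through the sign criterion for
        \<open>(h, k)\<close> at the point \<open>y j\<close>.\<close>
      have fg0: "(1 - \<gamma> j) * nD f g v (y j) + \<gamma> j * nD f g u (y j) = 0" for j
        using fg.integral_nD_gen_mean[OF bpm x, of j]
        unfolding y_def[symmetric] fg.integral_nD_mix_dirac[OF x \<gamma>' t] tu tv .
      have hk0: "0 \<le> (1 - \<gamma> j) * nD h k v (y j) + \<gamma> j * nD h k u (y j)" for j
        using le[OF t x, of j] hk.le_gen_mean_iff[OF bpm x yr[of j], of j]
        unfolding y_def[symmetric] hk.integral_nD_mix_dirac[OF x \<gamma>' t] tu tv by simp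
      \<comment> \<open>At \<open>y j = v\<close> the equation would reduce to
        \<open>\<gamma> j * nD f g u v = 0\<close> with \<open>\<gamma> j > 0\<close> and
        \<open>u \<noteq> v\<close>. Avoiding \<open>v\<close> permits division by
        \<open>nD f g v (y j)\<close> and a limit along the punctured neighbourhoods of
        \<open>v\<close>.\<close>
      have yv: "y j \<noteq> v" for j
      proof
        assume "y j = v"
        then have "nD f g u v = 0" using fg0[of j] \<gamma>(2)[of j] by simp
        then show False
          using fg.DD_nonzero[OF uvI False] uvI by (simp add: fg.nD_eq_0_iff)
      qed
      have "y \<longlonglongrightarrow> v"
        using fg.gen_mean_mix_dirac_tendsto[OF x t \<gamma>] unfolding y_def[abs_def] tv .
      then have y_at: "filterlim y (at v) sequentially"
        using yv by (simp add: filterlim_at)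
      define R where "R j = nD h k v (y j) / nD f g v (y j)" for j
      have R1: "R \<longlonglongrightarrow> 1"
        unfolding R_def
        by (rule filterlim_compose[OF nD_ratio_tendsto[OF fg.C1_chebyshev_pair_axioms
              hk.C1_chebyshev_pair_axioms uvI(2)] y_at])
      have "R j * nD f g u (y j) \<le> nD h k u (y j)" for j
      proof -
        have "nD f g v (y j) \<noteq> 0"
          using fg.DD_nonzero[OF uvI(2) yI yv[symmetric]] yI by (simp add: fg.nD_eq_0_iff)
        then have R: "R j * nD f g v (y j) = nD h k v (y j)"
          by (simp add: R_def)
        have fg_u: "\<gamma> j * nD f g u (y j) = - (1 - \<gamma> j) * nD f g v (y j)"
          using fg0[of j] by linarith
        \<comment> \<open>Multiplying the equation by \<open>R j\<close> turns its term at
          \<open>v\<close> into the one for \<open>(h, k)\<close>, where the inequality applies;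
          then the positive factor \<open>\<gamma> j\<close> cancels.\<close>
        have "\<gamma> j * (R j * nD f g u (y j)) = - (1 - \<gamma> j) * (R j * nD f g v (y j))"
          using fg_u by (metis mult.left_commute)
        also have "\<dots> \<le> \<gamma> j * nD h k u (y j)"
          using hk0[of j] unfolding R by linarith
        finally show ?thesis using \<gamma>(2)[of j] by simp
      qed
      moreover have "(\<lambda>j. R j * nD f g u (y j)) \<longlonglongrightarrow> 1 * nD f g u v"
        using continuous_on_tendsto_compose[OF fg.continuous_nD \<open>y \<longlonglongrightarrow> v\<close>] uvI yI
        by (intro tendsto_mult R1) auto
      moreover have "(\<lambda>j. nD h k u (y j)) \<longlonglongrightarrow> nD h k u v"
        using continuous_on_tendsto_compose[OF hk.continuous_nD \<open>y \<longlonglongrightarrow> v\<close>] uvI yI by auto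
      ultimately show ?thesis
        using LIMSEQ_le[of "\<lambda>j. R j * nD f g u (y j)" _ "\<lambda>j. nD h k u (y j)"] by simp
    qed
    then show ?thesis
      by (auto simp: assertion_iii_def U_set_def nD_def)
  qed
  moreover have "assertion_i" if iii: assertion_iii
    unfolding assertion_i_def
  proof (intro allI impI ballI)
    fix \<mu> :: "'t measure" and x :: "real ^ 'n"
    assume bpm: "borel_prob_measure T \<mu>" and x: "x \<in> cube I"
    let ?y = "gen_mean T f g m \<mu> x"
    have yr: "?y \<in> {m_low T m x..m_up T m x}"
      by (rule fg.gen_mean_in_range[OF bpm x])
    interpret rfg: C1_chebyshev_rv I f g \<mu> "m x" "m_low T m x" "m_up T m x"
      by (rule fg.C1_chebyshev_rv_mean[OF bpm x])
    interpret rhk: C1_chebyshev_rv I h k \<mu> "m x" "m_low T m x" "m_up T m x"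
      by (rule hk.C1_chebyshev_rv_mean[OF bpm x])
    have "0 = (LINT t|\<mu>. nD f g (m x t) ?y)"
      using fg.integral_nD_gen_mean[OF bpm x] by simp
    \<comment> \<open>(iii) is integrated over \<open>u = m x t\<close> with \<open>v\<close> fixed
      at the \<open>(f, g)\<close>-mean; nonnegativity of the result places that mean below the
      \<open>(h, k)\<close>-mean.\<close>
    also have "\<dots> \<le> (LINT t|\<mu>. nD h k (m x t) ?y)"
    proof (rule integral_mono[OF rfg.integrable_nD rhk.integrable_nD])
      fix t assume "t \<in> space \<mu>"
      then have "(m x t, ?y) \<in> U_set I T m"
        using rfg.X_range yr x by (auto simp: U_set_def)
      then show "nD f g (m x t) ?y \<le> nD h k (m x t) ?y"
        using iii by (auto simp: assertion_iii_def nD_def)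
    qed
    finally show "?y \<le> gen_mean T h k m \<mu> x"
      by (simp add: hk.le_gen_mean_iff[OF bpm x yr])
  qed
  ultimately show ?thesis by blast
qed

end
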